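(* Let $\mu\in\mathbb{R}$, $\sigma>0$, and let $\nu$ be the lognormal distribution $\mathcal{LN}(\mu,\sigma^2)$. Let $\{Q_k\}_{k\in\mathbb{N}_0}$ be the sequence of orthonormal polynomials with respect to $\nu$. Then $\{Q_k\}_{k\in\mathbb{N}_0}$ is incomplete in $L^2(\nu)$; that is, the closed linear span of $\{Q_k\}_{k\in\mathbb{N}_0}$ in $L^2(\nu)$ is a proper subset of $L^2(\nu)$.
   Context: The lognormal distribution $\mathcal{LN}(\mu,\sigma^2)$ is the distribution of $e^Y$ where $Y$ is normal with mean $\mu$ and variance $\sigma^2$. All its moments are finite. The orthonormal polynomials $\{Q_k\}_{k\in\mathbb{N}_0}$ satisfy $\deg Q_k=k$ and $\int Q_iQ_j\,d\nu=\delta_{ij}$ (they are obtained by Gram--Schmidt orthonormalization of $1,x,x^2,\dots$ in $L^2(\nu)$ with inner product $\langle g,h\rangle=\int gh\,d\nu$). Explicitly, $$Q_{k}(x)=\frac{e^{-\frac{k^{2}\sigma^{2}}{2}}}{\sqrt{\left[e^{-\sigma^{2}},e^{-\sigma^{2}}\right]_{k}}}\sum_{i=0}^{k}(-1)^{k+i}e^{-i\mu-\frac{i^{2}\sigma^{2}}{2}}\,e_{k-i}\left(1,e^{\sigma^2},\ldots,e^{(k-1)\sigma^{2}}\right)x^{i},$$ where $e_{i}(X_1,\dots,X_k)$ denotes the $i$-th elementary symmetric polynomial ($e_0=1$) and $[x,q]_{n}=\prod_{i=0}^{n-1}(1-xq^{i})$. *)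

theory Defs
  imports "HOL-Probability.Probability" "HOL-Library.Function_Algebras"
    "HOL-Computational_Algebra.Polynomial"
begin

(* The second parameter of normal_density, hence of lognormal, is the standard deviation:
   lognormal m s is LN(m, s^2). *)
definition lognormal :: "real \<Rightarrow> real \<Rightarrow> real measure" where
  "lognormal \<mu> \<sigma> = distr (density lborel (\<lambda>y. ennreal (normal_density \<mu> \<sigma> y))) borel exp"

(* Elements of L2 are represented by functions rather than by classes modulo a.e. equality.
   Both L2_space M and every L2_closure M A are closed under a.e. equality of measurable
   functions, so a (strict) inclusion between them is the same for functions and for classes. *)
definition L2_space :: "'a measure \<Rightarrow> ('a \<Rightarrow> real) set" where
  "L2_space M = {f \<in> borel_measurable M. integrable M (\<lambda>x. (f x)\<^sup>2)}"

definition L2_norm :: "'a measure \<Rightarrow> ('a \<Rightarrow> real) \<Rightarrow> real" where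
  "L2_norm M f = sqrt (\<integral>x. (f x)\<^sup>2 \<partial>M)"

(* The intersection with L2_space keeps out functions whose L2_norm is meaningless because
   the Bochner integral of a non-integrable function is 0. *)
definition L2_closure :: "'a measure \<Rightarrow> ('a \<Rightarrow> real) set \<Rightarrow> ('a \<Rightarrow> real) set" where
  "L2_closure M A =
     {f \<in> L2_space M. \<forall>\<epsilon>>0. \<exists>g \<in> A \<inter> L2_space M. L2_norm M (\<lambda>x. f x - g x) < \<epsilon>}"

definition fun_span :: "('a \<Rightarrow> real) set \<Rightarrow> ('a \<Rightarrow> real) set" where
  "fun_span = module.span (\<lambda>c f x. c * f x)"

definition L2_closed_span :: "'a measure \<Rightarrow> ('a \<Rightarrow> real) set \<Rightarrow> ('a \<Rightarrow> real) set" where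
  "L2_closed_span M A = L2_closure M (fun_span A)"

(* Determines Q only up to the sign of each Q k; Gram-Schmidt yields the choice with
   positive leading coefficients. *)
definition orthonormal_polynomials :: "real measure \<Rightarrow> (nat \<Rightarrow> real poly) \<Rightarrow> bool" where
  "orthonormal_polynomials M Q \<longleftrightarrow>
     (\<forall>k. degree (Q k) = k \<and> poly (Q k) \<in> L2_space M) \<and>
     (\<forall>i j. (\<integral>x. poly (Q i) x * poly (Q j) x \<partial>M) = (if i = j then 1 else 0))"

end

theory Submission
  imports Defs
begin

text \<open>
  Put \<open>h x = sin (2 * pi * (ln x - \<mu>) / \<sigma>\<^sup>2)\<close>. Completing the square shows that, for \<open>x = exp y\<close>, the
  weight \<open>x ^ n\<close> turns the normal density of \<open>y\<close> into a multiple of the normal density with mean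
  \<open>\<mu> + n * \<sigma>\<^sup>2\<close>. As \<open>y \<mapsto> h (exp y)\<close> has period \<open>\<sigma>\<^sup>2\<close> and is odd about \<open>\<mu>\<close>, it is also odd about this
  mean, so \<open>h\<close> is orthogonal to every monomial. Being nonzero in \<open>L\<^sup>2\<close>, it therefore cannot be
  approximated by polynomials.
\<close>

lemma module_fun_scale:
  "module (\<lambda>(c::'b::comm_ring_1) (f::'a \<Rightarrow> 'b) x. c * f x)"
  by unfold_locales (auto simp: fun_eq_iff algebra_simps)

text \<open>The approximants in the closed span enter the final argument only as polynomials. The
  inclusion holds by minimality of the span, since polynomial functions form a subspace.\<close>

lemma fun_span_polys_subset:
  fixes Q :: "'i \<Rightarrow> real poly"
  shows "fun_span (range (\<lambda>k. poly (Q k))) \<subseteq> range poly"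
proof -
  interpret module "\<lambda>(c::real) (f::real \<Rightarrow> real) x. c * f x"
    by (rule module_fun_scale)
  have "subspace (range (poly :: real poly \<Rightarrow> _))"
  proof (rule subspaceI)
    show "0 \<in> range (poly :: real poly \<Rightarrow> _)"
      by (rule image_eqI[of _ _ 0]) (auto simp: fun_eq_iff)
  next
    fix f g :: "real \<Rightarrow> real" assume "f \<in> range poly" "g \<in> range poly"
    then obtain p q where "f = poly p" "g = poly q" by blast
    then have "f + g = poly (p + q)" by (auto simp: fun_eq_iff)
    then show "f + g \<in> range poly" by blast
  next
    fix c :: real and f :: "real \<Rightarrow> real" assume "f \<in> range poly"
    then obtain p where "f = poly p" by blast
    then have "(\<lambda>x. c * f x) = poly (smult c p)" by (auto simp: fun_eq_iff)
    then show "(\<lambda>x. c * f x) \<in> range poly" by blast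
  qed
  then show ?thesis
    unfolding fun_span_def by (intro span_minimal) auto
qed

text \<open>Reflection about \<open>c\<close> preserves Lebesgue measure and negates
  \<open>f\<close>. The substitution is also valid for non-integrable \<open>f\<close>, where both
  integrals take the default value 0.\<close>

lemma integral_odd_eq_0:
  fixes f :: "real \<Rightarrow> real"
  assumes "\<And>t. f (c - t) = - f (c + t)"
  shows "(\<integral>x. f x \<partial>lborel) = 0"
proof -
  have "(\<integral>x. f x \<partial>lborel) = (\<integral>x. f (2 * c + (-1) * x) \<partial>lborel)"
    using lborel_integral_real_affine[of "-1" f "2 * c"] by simp
  also have "(\<lambda>x. f (2 * c + (-1) * x)) = (\<lambda>x. - f x)"
    using assms[of "_ - c"] by (auto simp: fun_eq_iff algebra_simps)
  finally show ?thesis by simp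
qed

text \<open>The constant factor is the moment generating function of the normal law at
  \<open>a\<close>. Besides the shift of the mean, the identity therefore gives finiteness of all
  lognormal moments.\<close>

lemma normal_density_mult_exp:
  assumes "\<sigma> > 0"
  shows "normal_density \<mu> \<sigma> y * exp (a * y) =
    exp (a * \<mu> + a\<^sup>2 * \<sigma>\<^sup>2 / 2) * normal_density (\<mu> + a * \<sigma>\<^sup>2) \<sigma> y"
proof -
  have "- (y - \<mu>)\<^sup>2 / (2 * \<sigma>\<^sup>2) + a * y =
      (a * \<mu> + a\<^sup>2 * \<sigma>\<^sup>2 / 2) + - (y - (\<mu> + a * \<sigma>\<^sup>2))\<^sup>2 / (2 * \<sigma>\<^sup>2)"
    using assms by (simp add: field_simps power2_eq_square)
  from arg_cong[OF this, of exp] show ?thesis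
    by (simp add: normal_density_def flip: exp_add)
qed

lemma sets_lognormal [simp, measurable_cong]: "sets (lognormal \<mu> \<sigma>) = sets borel"
  by (simp add: lognormal_def)

lemma integrable_lognormal_iff:
  fixes f :: "real \<Rightarrow> real"
  assumes [measurable]: "f \<in> borel_measurable borel"
  shows "integrable (lognormal \<mu> \<sigma>) f \<longleftrightarrow>
    integrable lborel (\<lambda>y. normal_density \<mu> \<sigma> y * f (exp y))"
  by (simp add: lognormal_def integrable_distr_eq integrable_density)

lemma integral_lognormal:
  fixes f :: "real \<Rightarrow> real"
  assumes [measurable]: "f \<in> borel_measurable borel"
  shows "integral\<^sup>L (lognormal \<mu> \<sigma>) f = (\<integral>y. normal_density \<mu> \<sigma> y * f (exp y) \<partial>lborel)"
  by (simp add: lognormal_def integral_distr integral_density)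

text \<open>The normal density is strictly positive, so a property that holds almost everywhere for
  the weighted measure also does so for \<open>lborel\<close>.\<close>

lemma AE_lognormal:
  assumes "\<sigma> > 0" "AE x in lognormal \<mu> \<sigma>. P x"
  shows "AE y in lborel. P (exp y)"
proof -
  have "AE y in density lborel (\<lambda>y. ennreal (normal_density \<mu> \<sigma> y)). P (exp y)"
    using assms(2) unfolding lognormal_def by (rule AE_distrD[rotated]) simp
  then show ?thesis
    using normal_density_pos[OF assms(1)] by (simp add: AE_density)
qed

lemma integrable_lognormal_power:
  assumes "\<sigma> > 0"
  shows "integrable (lognormal \<mu> \<sigma>) (\<lambda>x. x ^ n)"
  using assms normal_density_mult_exp[OF assms, of \<mu> _ "real n"]
  by (simp add: integrable_lognormal_iff exp_of_nat_mult[symmetric])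

text \<open>The values at x \<le> 0, where \<open>ln\<close> is a matter of convention, have no
  influence: \<open>lognormal\<close> is an image measure under \<open>exp\<close>.\<close>

definition lognormal_sine :: "real \<Rightarrow> real \<Rightarrow> real \<Rightarrow> real" where
  "lognormal_sine \<mu> \<sigma> x = sin (2 * pi * (ln x - \<mu>) / \<sigma>\<^sup>2)"

lemma lognormal_sine_measurable [measurable]: "lognormal_sine \<mu> \<sigma> \<in> borel_measurable borel"
  unfolding lognormal_sine_def[abs_def] by measurable

lemma abs_lognormal_sine_le: "\<bar>lognormal_sine \<mu> \<sigma> x\<bar> \<le> 1"
  by (simp add: lognormal_sine_def)

lemma lognormal_sine_exp_shift:
  assumes "\<sigma> > 0"
  shows "lognormal_sine \<mu> \<sigma> (exp (\<mu> + real n * \<sigma>\<^sup>2 + t)) = sin (2 * pi * t / \<sigma>\<^sup>2)"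
proof -
  \<comment> \<open>The shift of the mean by \<open>real n * \<sigma>\<^sup>2\<close> amounts to
    \<open>n\<close> full periods.\<close>
  have "2 * pi * (\<mu> + real n * \<sigma>\<^sup>2 + t - \<mu>) / \<sigma>\<^sup>2 = 2 * pi * t / \<sigma>\<^sup>2 + 2 * real n * pi"
    using assms by (simp add: field_simps)
  then show ?thesis
    by (simp add: lognormal_sine_def sin_add)
qed

lemma integral_power_mult_lognormal_sine:
  assumes "\<sigma> > 0"
  shows "(\<integral>x. x ^ n * lognormal_sine \<mu> \<sigma> x \<partial>lognormal \<mu> \<sigma>) = 0"
proof -
  define m where "m = \<mu> + real n * \<sigma>\<^sup>2"
  have odd: "lognormal_sine \<mu> \<sigma> (exp (m - t)) = - lognormal_sine \<mu> \<sigma> (exp (m + t))" for t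
    using lognormal_sine_exp_shift[OF assms, of \<mu> n t]
      lognormal_sine_exp_shift[OF assms, of \<mu> n "- t"]
    by (simp add: m_def)
  have "(\<integral>x. x ^ n * lognormal_sine \<mu> \<sigma> x \<partial>lognormal \<mu> \<sigma>) =
      (\<integral>y. (normal_density \<mu> \<sigma> y * exp (real n * y)) * lognormal_sine \<mu> \<sigma> (exp y) \<partial>lborel)"
    by (simp add: integral_lognormal exp_of_nat_mult mult.assoc)
  \<comment> \<open>The bracket is a constant times the normal density with mean \<open>m\<close>,
    which is even about \<open>m\<close>; the sine factor is odd about \<open>m\<close>.\<close>
  also have "\<dots> = 0"
    by (rule integral_odd_eq_0[of _ m])
      (simp add: normal_density_mult_exp[OF assms] odd, simp add: normal_density_def m_def)
  finally show ?thesis .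
qed

lemma integrable_mult_lognormal_sine:
  assumes "integrable (lognormal \<mu> \<sigma>) f"
  shows "integrable (lognormal \<mu> \<sigma>) (\<lambda>x. f x * lognormal_sine \<mu> \<sigma> x)"
proof (rule Bochner_Integration.integrable_bound[OF assms])
  show "(\<lambda>x. f x * lognormal_sine \<mu> \<sigma> x) \<in> borel_measurable (lognormal \<mu> \<sigma>)"
    using assms by measurable
  show "AE x in lognormal \<mu> \<sigma>. norm (f x * lognormal_sine \<mu> \<sigma> x) \<le> norm (f x)"
    by (simp add: abs_mult mult_left_le abs_lognormal_sine_le)
qed

lemma lognormal_sine_orthogonal_poly:
  assumes "\<sigma> > 0"
  shows "(\<integral>x. poly p x * lognormal_sine \<mu> \<sigma> x \<partial>lognormal \<mu> \<sigma>) = 0"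
  unfolding poly_altdef sum_distrib_right mult.assoc
  by (subst Bochner_Integration.integral_sum)
    (auto simp: integral_power_mult_lognormal_sine[OF assms]
      intro!: integrable_mult_lognormal_sine integrable_lognormal_power assms)

lemma integrable_lognormal_poly:
  assumes "\<sigma> > 0"
  shows "integrable (lognormal \<mu> \<sigma>) (poly p)"
  unfolding poly_altdef[abs_def] using integrable_lognormal_power[OF assms] by auto

lemma integrable_lognormal_sine_square:
  assumes "\<sigma> > 0"
  shows "integrable (lognormal \<mu> \<sigma>) (\<lambda>x. (lognormal_sine \<mu> \<sigma> x)\<^sup>2)"
  \<comment> \<open>The power with exponent 0 is the integrable constant 1; multiplying it twice by
    the bounded sine gives the square.\<close>
  using integrable_mult_lognormal_sine[OF integrable_mult_lognormal_sine[OF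
        integrable_lognormal_power[OF assms, of \<mu> 0]]]
  by (simp add: power2_eq_square)

text \<open>A zero integral would make the sine vanish for almost every \<open>y\<close> =
  \<open>ln x\<close>, but its zeros in \<open>y\<close> form a countable set, spaced by half a
  period.\<close>

lemma integral_lognormal_sine_square_pos:
  assumes "\<sigma> > 0"
  shows "(\<integral>x. (lognormal_sine \<mu> \<sigma> x)\<^sup>2 \<partial>lognormal \<mu> \<sigma>) > 0"
proof (rule ccontr)
  assume "\<not> ?thesis"
  then have "(\<integral>x. (lognormal_sine \<mu> \<sigma> x)\<^sup>2 \<partial>lognormal \<mu> \<sigma>) = 0"
    by (intro antisym Bochner_Integration.integral_nonneg) auto
  then have "AE x in lognormal \<mu> \<sigma>. (lognormal_sine \<mu> \<sigma> x)\<^sup>2 = 0"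
    by (subst (asm) integral_nonneg_eq_0_iff_AE)
      (auto intro: integrable_lognormal_sine_square[OF assms])
  from AE_lognormal[OF assms this]
  have zero: "AE y in lborel. sin (2 * pi * (y - \<mu>) / \<sigma>\<^sup>2) = 0"
    by (simp add: lognormal_sine_def)
  let ?Z = "range (\<lambda>i::int. \<mu> + of_int i * \<sigma>\<^sup>2 / 2)"
  have "?Z \<in> null_sets lborel"
    by (intro countable_imp_null_set_lborel) auto
  then have "AE y in lborel. y \<notin> ?Z"
    by (rule AE_not_in)
  moreover have "y \<in> ?Z" if "sin (2 * pi * (y - \<mu>) / \<sigma>\<^sup>2) = 0" for y
  proof -
    from that obtain i :: int where "2 * pi * (y - \<mu>) / \<sigma>\<^sup>2 = of_int i * pi"
      by (auto simp: sin_zero_iff_int2)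
    then have "pi * (2 * (y - \<mu>) / \<sigma>\<^sup>2) = pi * of_int i"
      by (simp add: mult_ac)
    then have "2 * (y - \<mu>) / \<sigma>\<^sup>2 = of_int i"
      by (simp only: mult_cancel_left pi_neq_zero simp_thms)
    then have "y = \<mu> + of_int i * \<sigma>\<^sup>2 / 2"
      using assms by (simp add: field_simps)
    then show ?thesis by blast
  qed
  ultimately have "AE y in lborel :: real measure. False"
    using zero by (auto elim: eventually_elim2)
  then show False
    \<comment> \<open>The exceptional set would be the whole line, which is not a null set.\<close>
    by (simp add: AE_iff_measurable[OF _ refl])
qed

lemma lognormal_sine_in_L2_space:
  assumes "\<sigma> > 0"
  shows "lognormal_sine \<mu> \<sigma> \<in> L2_space (lognormal \<mu> \<sigma>)"
  unfolding L2_space_def using integrable_lognormal_sine_square[OF assms] by simp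

text \<open>This is Pythagoras: by orthogonality, subtracting a polynomial adds its squared norm, so
  0 is a best polynomial approximation.\<close>

lemma L2_norm_lognormal_sine_le:
  assumes "\<sigma> > 0"
  shows "L2_norm (lognormal \<mu> \<sigma>) (lognormal_sine \<mu> \<sigma>) \<le>
    L2_norm (lognormal \<mu> \<sigma>) (\<lambda>x. lognormal_sine \<mu> \<sigma> x - poly p x)"
proof -
  let ?M = "lognormal \<mu> \<sigma>" and ?h = "lognormal_sine \<mu> \<sigma>"
  \<comment> \<open>The square of \<open>poly p\<close> is again a polynomial function, hence
    integrable. These facts allow the expanded integral to be split below.\<close>
  have int [simp]: "integrable ?M (\<lambda>x. (?h x)\<^sup>2)" "integrable ?M (\<lambda>x. (poly p x)\<^sup>2)"
    "integrable ?M (\<lambda>x. poly p x * ?h x)"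
    using integrable_lognormal_sine_square[OF assms]
      integrable_lognormal_poly[OF assms, of \<mu> "p\<^sup>2"]
      integrable_mult_lognormal_sine[OF integrable_lognormal_poly[OF assms]]
    by (simp_all add: poly_power[abs_def])
  have "(\<integral>x. (?h x - poly p x)\<^sup>2 \<partial>?M) =
      (\<integral>x. (?h x)\<^sup>2 + (poly p x)\<^sup>2 - 2 * (poly p x * ?h x) \<partial>?M)"
    by (simp add: power2_diff mult_ac)
  also have "\<dots> = (\<integral>x. (?h x)\<^sup>2 \<partial>?M) + (\<integral>x. (poly p x)\<^sup>2 \<partial>?M)"
    by (simp add: lognormal_sine_orthogonal_poly[OF assms])
  finally show ?thesis
    by (simp add: L2_norm_def)
qed

theorem proposition1p1:
  fixes \<mu> \<sigma> :: real and Q :: "nat \<Rightarrow> real poly"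
  assumes "\<sigma> > 0"
    and "orthonormal_polynomials (lognormal \<mu> \<sigma>) Q"
  shows "L2_closed_span (lognormal \<mu> \<sigma>) (range (\<lambda>k. poly (Q k))) \<subset> L2_space (lognormal \<mu> \<sigma>)"
proof (rule psubsetI)
  show "L2_closed_span (lognormal \<mu> \<sigma>) (range (\<lambda>k. poly (Q k))) \<subseteq> L2_space (lognormal \<mu> \<sigma>)"
    by (auto simp: L2_closed_span_def L2_closure_def)
  have "lognormal_sine \<mu> \<sigma> \<notin> L2_closed_span (lognormal \<mu> \<sigma>) (range (\<lambda>k. poly (Q k)))"
  proof
    assume "lognormal_sine \<mu> \<sigma> \<in> L2_closed_span (lognormal \<mu> \<sigma>) (range (\<lambda>k. poly (Q k)))"
    \<comment> \<open>The positive norm of the sine serves as \<epsilon> in the closure: no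
      polynomial comes closer to the sine than that.\<close>
    moreover have "L2_norm (lognormal \<mu> \<sigma>) (lognormal_sine \<mu> \<sigma>) > 0"
      using integral_lognormal_sine_square_pos[OF assms(1)] by (simp add: L2_norm_def)
    ultimately obtain g where "g \<in> fun_span (range (\<lambda>k. poly (Q k)))"
      and less: "L2_norm (lognormal \<mu> \<sigma>) (\<lambda>x. lognormal_sine \<mu> \<sigma> x - g x) <
        L2_norm (lognormal \<mu> \<sigma>) (lognormal_sine \<mu> \<sigma>)"
      unfolding L2_closed_span_def L2_closure_def by blast
    then obtain p where "g = poly p"
      using fun_span_polys_subset by blast
    with less L2_norm_lognormal_sine_le[OF assms(1), of \<mu> p] show False
      by simp
  qed
  with lognormal_sine_in_L2_space[OF assms(1), of \<mu>]
  show "L2_closed_span (lognormal \<mu> \<sigma>) (range (\<lambda>k. poly (Q k))) \<noteq> L2_space (lognormal \<mu> \<sigma>)"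
    by blast
qed

end
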